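(* Let $\mathcal{M}=(S,s_{\mathrm{init}},\{\mathit{good}\},V,\mathcal{P})$ be a parametric Markov chain with state reward function $\mathit{rew}\colon S\to\mathbb{R}$, let $R$ be a graph-preserving region, and assume that from every state $s\in S$ the state $\mathit{good}$ is reached with probability $1$ under every instantiation $u\in R$. Let $p\in V$. Consider the following system of equations in the unknowns $x_s$ and $\partial_p x_s$ ($s\in S$): \begin{align*} x_{\mathit{good}}&=0,\qquad \partial_p x_{\mathit{good}}=0,\\ x_s&=\mathit{rew}(s)+\sum_{s'\in S}\mathcal{P}(s,s')\cdot x_{s'} &&\text{for } s\in S\setminus\{\mathit{good}\},\\ \partial_p x_s&=\sum_{s'\in S}\big(\partial_p\mathcal{P}(s,s')\cdot x_{s'}+\mathcal{P}(s,s')\cdot \partial_p x_{s'}\big) &&\text{for } s\in S\setminus\{\mathit{good}\}, \end{align*} where $\partial_p\mathcal{P}(s,s')$ is the partial derivative of the polynomial $\mathcal{P}(s,s')$ with respect to $p$. Then this system has exactly one solution, and in it $x_s=\mathrm{ER}_s$ and $\partial_p x_s=\partial_p\,\mathrm{ER}_s$ for every $s\in S$, where $\mathrm{ER}_s\colon R\to\mathbb{R}$ is the expected reward function until reaching $\mathit{good}$ from $s$.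
   Context: $V=\{p_1,\dots,p_n\}$ is a finite set of real-valued parameters, $\mathbb{R}[V]$ the multivariate polynomials over $V$. An instantiation is a map $u\colon V\to\mathbb{R}$; each parameter is bounded, $u(p_i)\in[\mathit{lb}_i,\mathit{ub}_i]$, and a region is a set of instantiations. For a polynomial $f$, $f[u]$ denotes its evaluation at $u$. A parametric Markov chain (pMC) $\mathcal{M}=(S,s_{\mathrm{init}},T,V,\mathcal{P})$ has a finite state set $S$, initial state $s_{\mathrm{init}}$, target set $T$ (here merged into a single state $\mathit{good}$), and transition function $\mathcal{P}\colon S\to(S\to\mathbb{R}[V])$ such that for every instantiation $u$ in the parameter space, $0\le \mathcal{P}(s,t)[u]\le1$ and $\sum_t\mathcal{P}(s,t)[u]=1$. $\mathcal{M}[u]$ is the Markov chain obtained by substituting $u$. An instantiation $u$ is graph-preserving if $\mathcal{P}(s,s')\neq0$ implies $\mathcal{P}(s,s')[u]\neq0$ for all $s,s'$; a region is graph-preserving if all its instantiations are. For a path $\pi=s_0s_1\dots$ that first hits $\mathit{good}$ at position $n$, its reward is $\mathit{rew}(s_0)+\dots+\mathit{rew}(s_{n-1})$ (and $\infty$ if it never reaches $\mathit{good}$). $\mathrm{ER}_s[u]$ is the expectation of this path reward in the Markov chain $\mathcal{M}[u]$ starting from $s$; on a graph-preserving region it is a continuously differentiable (rational) function of the parameters, and $\partial_p\mathrm{ER}_s$ is its partial derivative with respect to $p$. *)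

theory Defs
  imports "HOL-Probability.Probability" "HOL-Library.Poly_Mapping"
begin

(* Multivariate real polynomials, with monomials given by their exponent functions.  The finite
   set V of parameters is the universe of the type 'v, the finite set S of states the universe
   of the type 's. *)

type_synonym 'v mpoly = "('v \<Rightarrow>\<^sub>0 nat) \<Rightarrow>\<^sub>0 real"

type_synonym 'v inst = "'v \<Rightarrow> real"

definition mpoly_eval :: "'v mpoly \<Rightarrow> 'v inst \<Rightarrow> real" where
  "mpoly_eval f u =
     (\<Sum>m\<in>Poly_Mapping.keys f. Poly_Mapping.lookup f m *
        (\<Prod>q\<in>Poly_Mapping.keys m. u q ^ Poly_Mapping.lookup m q))"

(* Formal partial derivative.  If p does not occur in m, the truncated exponent subtraction is
   harmless since the coefficient vanishes. *)
definition mpoly_pderiv :: "'v \<Rightarrow> 'v mpoly \<Rightarrow> 'v mpoly" where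
  "mpoly_pderiv p f =
     (\<Sum>m\<in>Poly_Mapping.keys f.
        Poly_Mapping.single (m - Poly_Mapping.single p 1)
          (Poly_Mapping.lookup f m * real (Poly_Mapping.lookup m p)))"

definition param_space :: "('v \<Rightarrow> real) \<Rightarrow> ('v \<Rightarrow> real) \<Rightarrow> 'v inst set" where
  "param_space lb ub = {u. \<forall>q. lb q \<le> u q \<and> u q \<le> ub q}"

record ('s, 'v) pmc =
  init :: 's
  target :: "'s set"
  trans :: "'s \<Rightarrow> 's \<Rightarrow> 'v mpoly"

definition is_pmc :: "('v \<Rightarrow> real) \<Rightarrow> ('v \<Rightarrow> real) \<Rightarrow> ('s::finite, 'v) pmc \<Rightarrow> bool" where
  "is_pmc lb ub M \<longleftrightarrow>
     (\<forall>u\<in>param_space lb ub. \<forall>s.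
        (\<forall>t. 0 \<le> mpoly_eval (trans M s t) u \<and> mpoly_eval (trans M s t) u \<le> 1) \<and>
        (\<Sum>t\<in>UNIV. mpoly_eval (trans M s t) u) = 1)"

definition graph_preserving :: "('s, 'v) pmc \<Rightarrow> 'v inst set \<Rightarrow> bool" where
  "graph_preserving M R \<longleftrightarrow>
     (\<forall>u\<in>R. \<forall>s t. trans M s t \<noteq> 0 \<longrightarrow> mpoly_eval (trans M s t) u \<noteq> 0)"

(* The transition kernel of the instantiated chain M[u]; meaningful only for u in the parameter
   space of a pMC, where the evaluated rows are probability distributions. *)
definition inst_kernel :: "('s, 'v) pmc \<Rightarrow> 'v inst \<Rightarrow> 's \<Rightarrow> 's pmf" where
  "inst_kernel M u s = embed_pmf (\<lambda>t. mpoly_eval (trans M s t) u)"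

(* Distribution of position i of a path, given the positions before i. *)
definition mc_step :: "('s \<Rightarrow> 's pmf) \<Rightarrow> 's \<Rightarrow> nat \<Rightarrow> (nat \<Rightarrow> 's) \<Rightarrow> 's measure" where
  "mc_step K s i \<omega> =
     measure_pmf (case i of 0 \<Rightarrow> return_pmf s | Suc j \<Rightarrow> K (\<omega> j))"

(* The law, on infinite paths, of the Markov chain with kernel K started in s: the limit measure
   of the Ionescu-Tulcea extension theorem (inside that locale it is called PF.lim). *)
definition path_measure :: "('s \<Rightarrow> 's pmf) \<Rightarrow> 's \<Rightarrow> (nat \<Rightarrow> 's) measure" where
  "path_measure K s =
     projective_family.lim UNIV
       (Ionescu_Tulcea.CI (mc_step K s) (\<lambda>_. count_space UNIV)) (\<lambda>_. count_space UNIV)"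

definition path_reward :: "'s set \<Rightarrow> ('s \<Rightarrow> real) \<Rightarrow> (nat \<Rightarrow> 's) \<Rightarrow> ereal" where
  "path_reward T rew \<omega> =
     (if \<exists>n. \<omega> n \<in> T then ereal (\<Sum>i<(LEAST n. \<omega> n \<in> T). rew (\<omega> i)) else \<infinity>)"

(* Expectation of an extended real random variable: positive minus negative part.  As
   \<infinity> - \<infinity> = \<infinity> in ereal, a real value entails that both parts have finite expectation. *)
definition ereal_expectation :: "'a measure \<Rightarrow> ('a \<Rightarrow> ereal) \<Rightarrow> ereal" where
  "ereal_expectation N f =
     enn2ereal (\<integral>\<^sup>+\<omega>. e2ennreal (f \<omega>) \<partial>N) - enn2ereal (\<integral>\<^sup>+\<omega>. e2ennreal (- f \<omega>) \<partial>N)"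

definition exp_reward :: "('s, 'v) pmc \<Rightarrow> ('s \<Rightarrow> real) \<Rightarrow> 's \<Rightarrow> 'v inst \<Rightarrow> ereal" where
  "exp_reward M rew s u =
     ereal_expectation (path_measure (inst_kernel M u) s) (path_reward (target M) rew)"

(* D is the partial derivative of F with respect to p at u, for F defined on U.  At boundary
   points of a box U this is a one-sided derivative; if U does not vary in direction p at u, then F
   has no partial derivative there to speak of and the condition is void. *)
definition has_partial_derivative ::
    "('v inst \<Rightarrow> real) \<Rightarrow> 'v \<Rightarrow> real \<Rightarrow> 'v inst \<Rightarrow> 'v inst set \<Rightarrow> bool" where
  "has_partial_derivative F p D u U \<longleftrightarrow>
     ((\<lambda>t. F (u(p := t))) has_real_derivative D) (at (u p) within {t. u(p := t) \<in> U})"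

(* The unknowns are functions on the region R; dx s is an unknown in its own right and not
   assumed to be a derivative of x s.  Functions on R are represented by total functions that are
   undefined outside R. *)
definition solves_system ::
    "('s::finite, 'v) pmc \<Rightarrow> ('s \<Rightarrow> real) \<Rightarrow> 's \<Rightarrow> 'v \<Rightarrow> 'v inst set \<Rightarrow>
      ('s \<Rightarrow> 'v inst \<Rightarrow> real) \<Rightarrow> ('s \<Rightarrow> 'v inst \<Rightarrow> real) \<Rightarrow> bool" where
  "solves_system M rew good p R x dx \<longleftrightarrow>
     (\<forall>s. x s \<in> extensional R \<and> dx s \<in> extensional R) \<and>
     (\<forall>u\<in>R.
        x good u = 0 \<and> dx good u = 0 \<and>
        (\<forall>s. s \<noteq> good \<longrightarrow>
           x s u = rew s + (\<Sum>t\<in>UNIV. mpoly_eval (trans M s t) u * x t u) \<and>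
           dx s u = (\<Sum>t\<in>UNIV. mpoly_eval (mpoly_pderiv p (trans M s t)) u * x t u
                              + mpoly_eval (trans M s t) u * dx t u)))"

end

theory Submission
  imports Defs
begin

text \<open>
  Let \<open>B\<close> be the transition operator killed at \<open>good\<close>; both families of equations have the form
  \<open>x = c + B x\<close>.  Since \<open>B\<^sup>n 1\<close> is the probability of not having reached \<open>good\<close> by time \<open>n\<close>, almost sure
  reachability makes a finite sum \<open>w\<close> of these functions a Lyapunov function: \<open>w \<ge> \<delta> + B w\<close> off \<open>good\<close>.
  Then \<open>|x| \<le> sup |c| / \<delta> * w\<close> for every solution, which gives uniqueness, and \<open>\<Sum>n. B\<^sup>n c\<close> converges
  to the solution; for \<open>c = rew\<close> this series is the expected reward.  With \<open>\<delta> / 2\<close> in place of \<open>\<delta>\<close>, the same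
  \<open>w\<close> works for all nearby instantiations, which controls the difference quotients uniformly.
\<close>

section \<open>Linear systems for a killed transition operator\<close>

text \<open>Zeroing the row of \<open>good\<close> builds the boundary condition into the operator,
  so that a single fixed point equation covers all states. \<open>P\<close> is an arbitrary matrix
  because the operator is also formed from derivatives and difference quotients of the transition
  probabilities.\<close>

definition killed_op :: "'s \<Rightarrow> ('s \<Rightarrow> 's \<Rightarrow> real) \<Rightarrow> ('s \<Rightarrow> real) \<Rightarrow> 's \<Rightarrow> real" where
  "killed_op good P g s = (if s = good then 0 else \<Sum>t\<in>UNIV. P s t * g t)"

lemma killed_op_good [simp]: "killed_op good P g good = 0"
  by (simp add: killed_op_def)

lemma killed_op_linear:
  "killed_op good P (\<lambda>t. a * g t) s = a * killed_op good P g s"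
  "killed_op good P (\<lambda>t. g t + h t) s = killed_op good P g s + killed_op good P h s"
  "killed_op good P (\<lambda>t. g t - h t) s = killed_op good P g s - killed_op good P h s"
  by (simp_all add: killed_op_def sum_distrib_left algebra_simps sum.distrib sum_subtractf)

lemma killed_op_sum:
  "killed_op good P (\<lambda>t. \<Sum>i\<in>I. g i t) s = (\<Sum>i\<in>I. killed_op good P (g i) s)"
  unfolding killed_op_def by (auto simp: sum_distrib_left intro: sum.swap)

lemma killed_op_funpow_good:
  "g good = 0 \<Longrightarrow> (killed_op good P ^^ n) g good = 0"
  by (cases n) auto

lemma killed_op_funpow_diff:
  "(killed_op good P ^^ n) (\<lambda>t. g t - h t) s = (killed_op good P ^^ n) g s - (killed_op good P ^^ n) h s"
proof (induction n arbitrary: s)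
  case (Suc n)
  have "(killed_op good P ^^ n) (\<lambda>t. g t - h t) =
      (\<lambda>s. (killed_op good P ^^ n) g s - (killed_op good P ^^ n) h s)"
    using Suc by blast
  then show ?case
    by (simp add: killed_op_linear)
qed simp

context
  fixes good :: "'s::finite" and P :: "'s \<Rightarrow> 's \<Rightarrow> real"
  assumes P_nonneg: "\<And>s t. 0 \<le> P s t"
begin

lemma killed_op_abs_le:
  assumes "\<And>t. \<bar>g t\<bar> \<le> h t"
  shows "\<bar>killed_op good P g s\<bar> \<le> killed_op good P h s"
proof -
  have "\<bar>\<Sum>t\<in>UNIV. P s t * g t\<bar> \<le> (\<Sum>t\<in>UNIV. \<bar>P s t * g t\<bar>)" by simp
  also have "\<dots> \<le> (\<Sum>t\<in>UNIV. P s t * h t)"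
    using assms P_nonneg by (auto intro!: sum_mono mult_left_mono simp: abs_mult)
  finally show ?thesis by (simp add: killed_op_def)
qed

lemma killed_op_funpow_nonneg:
  assumes "\<And>t. 0 \<le> g t"
  shows "0 \<le> (killed_op good P ^^ n) g s"
proof (induction n arbitrary: s)
  case (Suc n)
  then show ?case
    using P_nonneg by (auto simp: killed_op_def intro!: sum_nonneg)
qed (simp add: assms)

end

text \<open>For stochastic \<open>P\<close>, \<open>w\<close> divided by \<delta> is a supersolution
  of the equations for the expected time to reach \<open>good\<close>. The drift \<delta> is a
  parameter so that a perturbation of \<open>P\<close> can use up part of it.\<close>

definition lyapunov :: "'s \<Rightarrow> ('s \<Rightarrow> 's \<Rightarrow> real) \<Rightarrow> real \<Rightarrow> ('s \<Rightarrow> real) \<Rightarrow> bool" where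
  "lyapunov good P \<delta> w \<longleftrightarrow> 0 < \<delta> \<and> w good = 0 \<and>
     (\<forall>s. 0 \<le> w s) \<and> (\<forall>s. s \<noteq> good \<longrightarrow> \<delta> + killed_op good P w s \<le> w s)"

text \<open>The operator shifts the sum \<open>w\<close> by one index, so \<open>w\<close> minus its
  image telescopes to the term of index 0 minus that of index \<open>n\<close>. Off
  \<open>good\<close> the former is 1, and the latter is below 1/2 for one \<open>n\<close> common
  to the finitely many states.\<close>

lemma lyapunov_exists:
  fixes good :: "'s::finite"
  assumes P: "\<And>s t. 0 \<le> P s t"
    and lim: "\<And>s. (\<lambda>n. (killed_op good P ^^ n) (\<lambda>s. of_bool (s \<noteq> good)) s) \<longlonglongrightarrow> 0"
  shows "\<exists>w. lyapunov good P (1/2) w"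
proof -
  let ?q = "\<lambda>n. (killed_op good P ^^ n) (\<lambda>s. of_bool (s \<noteq> good))"
  have "eventually (\<lambda>n. \<forall>s. ?q n s < 1/2) sequentially"
    by (intro eventually_all_finite order_tendstoD(2)[OF lim]) simp
  then obtain n where n: "\<And>s. ?q n s < 1/2"
    by (auto simp: eventually_sequentially)
  define w where "w s = (\<Sum>i<n. ?q i s)" for s
  have "killed_op good P w s = (\<Sum>i<n. ?q (Suc i) s)" for s
    unfolding w_def by (simp add: killed_op_sum)
  also have "(\<Sum>i<n. ?q (Suc i) s) = w s - of_bool (s \<noteq> good) + ?q n s" for s
    using sum.lessThan_Suc_shift[of "\<lambda>i. ?q i s" n] by (simp add: w_def)
  finally have "killed_op good P w s = w s - of_bool (s \<noteq> good) + ?q n s" for s .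
  then have "1/2 + killed_op good P w s \<le> w s" if "s \<noteq> good" for s
    using that n[of s] by (simp add: less_imp_le)
  moreover have "0 \<le> w s" for s
    unfolding w_def by (intro sum_nonneg killed_op_funpow_nonneg P) simp
  moreover have "w good = 0"
    unfolding w_def by (simp add: killed_op_funpow_good)
  ultimately have "lyapunov good P (1/2) w"
    by (simp add: lyapunov_def)
  then show ?thesis by (rule exI[of _ w])
qed

context
  fixes good :: "'s::finite" and P :: "'s \<Rightarrow> 's \<Rightarrow> real" and \<delta> :: real and w :: "'s \<Rightarrow> real"
  assumes P_nonneg: "\<And>s t. 0 \<le> P s t" and lyap: "lyapunov good P \<delta> w"
begin

lemma lyapunov_pos: "s \<noteq> good \<Longrightarrow> 0 < w s"
proof -
  assume s: "s \<noteq> good"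
  have "0 \<le> killed_op good P w s"
    using killed_op_funpow_nonneg[OF P_nonneg, where g = w and n = 1 and s = s and good = good] lyap by (auto simp: lyapunov_def)
  then show ?thesis
    using lyap s unfolding lyapunov_def by force
qed

text \<open>\<rho> is the sup norm of \<open>x\<close> weighted by \<open>w\<close>, attained
  because there are finitely many states. At \<open>good\<close> the quotient is 0/0 = 0, so a
  maximum attained there means \<rho> = 0.\<close>

lemma lyapunov_dominates:
  assumes "x good = 0"
  shows "\<exists>\<rho>\<ge>0. (\<forall>s. \<bar>x s\<bar> \<le> \<rho> * w s) \<and> (\<exists>s. \<bar>x s\<bar> = \<rho> * w s \<and> (s = good \<longrightarrow> \<rho> = 0))"
proof -
  define \<rho> where "\<rho> = Max (range (\<lambda>s. \<bar>x s\<bar> / w s))"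
  have w: "0 \<le> w s" for s using lyap by (auto simp: lyapunov_def)
  have le: "\<bar>x s\<bar> / w s \<le> \<rho>" for s
    unfolding \<rho>_def by (rule Max_ge) auto
  have "0 \<le> \<rho>"
    by (rule order_trans[OF divide_nonneg_nonneg[OF abs_ge_zero w] le])
  moreover have "\<bar>x s\<bar> \<le> \<rho> * w s" for s
    using le[of s] lyapunov_pos[of s] assms lyap
    by (cases "s = good") (auto simp: lyapunov_def field_simps)
  moreover have "\<rho> \<in> range (\<lambda>s. \<bar>x s\<bar> / w s)"
    unfolding \<rho>_def by (rule Max_in) auto
  then obtain s where "\<rho> = \<bar>x s\<bar> / w s" by blast
  then have "\<bar>x s\<bar> = \<rho> * w s \<and> (s = good \<longrightarrow> \<rho> = 0)"
    using lyapunov_pos[of s] assms by (cases "s = good") auto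
  ultimately show ?thesis by blast
qed

text \<open>A maximum principle for the ratio of \<open>\<bar>x\<bar>\<close> and \<open>w\<close>.\<close>

lemma lyapunov_bound:
  assumes x: "\<And>s. x s = c s + killed_op good P x s" and c: "c good = 0"
    and \<gamma>: "\<And>s. \<bar>c s\<bar> \<le> \<gamma>"
  shows "\<bar>x s\<bar> \<le> \<gamma> / \<delta> * w s"
proof -
  have "x good = 0" using x[of good] c by simp
  then obtain \<rho> r where \<rho>: "0 \<le> \<rho>" "\<And>s. \<bar>x s\<bar> \<le> \<rho> * w s"
    and r: "\<bar>x r\<bar> = \<rho> * w r" "r = good \<longrightarrow> \<rho> = 0"
    using lyapunov_dominates[of x] by blast
  have \<delta>: "0 < \<delta>" using lyap by (simp add: lyapunov_def)
  have \<gamma>0: "0 \<le> \<gamma>" using \<gamma>[of s] by linarith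
  have "\<rho> \<le> \<gamma> / \<delta>"
  proof (cases "r = good")
    case True
    then show ?thesis using r \<gamma>0 \<delta> by simp
  next
    case False
    \<comment> \<open>At the maximising state the domination of \<open>x\<close> is an equality. The
      terms \<open>\<rho> * w r\<close> then cancel along the chain and leave
      \<open>\<rho> * \<delta> \<le> \<gamma>\<close>.\<close>
    have "\<rho> * w r \<le> \<bar>c r\<bar> + \<bar>killed_op good P x r\<bar>"
      using r(1) x[of r] by linarith
    also have "\<dots> \<le> \<gamma> + \<rho> * killed_op good P w r"
      using \<gamma>[of r] killed_op_abs_le[of P x "\<lambda>s. \<rho> * w s" good r, OF P_nonneg \<rho>(2)] by (simp add: killed_op_linear)
    also have "\<dots> \<le> \<gamma> + \<rho> * (w r - \<delta>)"
      using lyap False \<rho>(1) unfolding lyapunov_def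
      by (intro add_left_mono mult_left_mono) (auto simp: algebra_simps)
    finally show ?thesis using \<delta> by (simp add: field_simps)
  qed
  then have "\<rho> * w s \<le> \<gamma> / \<delta> * w s"
    using lyap by (intro mult_right_mono) (auto simp: lyapunov_def)
  then show ?thesis
    using \<rho>(2)[of s] by linarith
qed

text \<open>The difference of two solutions solves the homogeneous system, where the bound applies
  with \<gamma> = 0.\<close>

lemma killed_op_solution_unique:
  assumes x: "\<And>s. x s = c s + killed_op good P x s"
    and y: "\<And>s. y s = c s + killed_op good P y s"
  shows "x = y"
proof
  fix s
  have "x s - y s = 0 + killed_op good P (\<lambda>s. x s - y s) s" for s
    using x[of s] y[of s] by (simp add: killed_op_linear)
  from lyapunov_bound[of "\<lambda>s. x s - y s" "\<lambda>_. 0" 0, OF this] show "x s = y s"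
    by simp
qed

text \<open>In the norm weighted by \<open>w\<close> the operator is a contraction: if
  \<open>W\<close> bounds \<open>w\<close>, then
  \<open>w - \<delta> \<le> (1 - \<delta> / W) * w\<close>. The iterates thus decay
  geometrically.\<close>

lemma killed_op_summable:
  assumes "c good = 0"
  shows "summable (\<lambda>n. (killed_op good P ^^ n) c s)"
proof -
  obtain \<rho> where \<rho>: "0 \<le> \<rho>" "\<And>s. \<bar>c s\<bar> \<le> \<rho> * w s"
    using lyapunov_dominates[of c, OF assms] by blast
  \<comment> \<open>Adding \<delta> to the maximum gives \<open>0 < \<delta> \<le> W\<close>, which
    places \<theta> in [0, 1) even if \<open>w\<close> vanishes everywhere.\<close>
  define W where "W = \<delta> + Max (range w)"
  have \<delta>: "0 < \<delta>" and w0: "0 \<le> w s" for s using lyap by (auto simp: lyapunov_def)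
  have wmax: "w s \<le> Max (range w)" for s by (rule Max_ge) auto
  have W: "w s \<le> W" "\<delta> \<le> W" "0 < W" for s
    using wmax[of s] wmax[of good] w0[of good] \<delta> unfolding W_def by linarith+
  define \<theta> where "\<theta> = 1 - \<delta> / W"
  have \<theta>: "0 \<le> \<theta>" "\<theta> < 1" using W \<delta> by (auto simp: \<theta>_def)
  have Bw: "killed_op good P w s \<le> \<theta> * w s" for s
  proof (cases "s = good")
    case False
    have "\<delta> / W * w s \<le> \<delta> / W * W" using W \<delta> by (intro mult_left_mono) auto
    then have "\<delta> / W * w s \<le> \<delta>" using W by simp
    then show ?thesis
      using lyap False unfolding lyapunov_def \<theta>_def by (auto simp: left_diff_distrib)
  qed (use \<theta> w0 in auto)
  have bound: "\<bar>(killed_op good P ^^ n) c s\<bar> \<le> \<rho> * \<theta> ^ n * w s" for n s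
  proof (induction n arbitrary: s)
    case (Suc n)
    have "\<bar>(killed_op good P ^^ Suc n) c s\<bar> \<le> \<rho> * \<theta> ^ n * killed_op good P w s"
      using killed_op_abs_le[of P "(killed_op good P ^^ n) c" "\<lambda>s. \<rho> * \<theta> ^ n * w s" good s, OF P_nonneg Suc] by (simp add: killed_op_linear)
    also have "\<dots> \<le> \<rho> * \<theta> ^ n * (\<theta> * w s)"
      using Bw \<rho>(1) \<theta>(1) by (intro mult_left_mono) auto
    finally show ?case by (simp add: ac_simps)
  qed (use \<rho> in simp)
  show ?thesis
  proof (rule summable_comparison_test)
    show "summable (\<lambda>n. \<rho> * w s * \<theta> ^ n)"
      using \<theta> by (intro summable_mult summable_geometric) simp
    show "\<exists>N. \<forall>n\<ge>N. norm ((killed_op good P ^^ n) c s) \<le> \<rho> * w s * \<theta> ^ n"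
      using bound[of _ s] by (simp add: ac_simps)
  qed
qed

text \<open>This is the Neumann series: after splitting off the first term, the operator, being a
  finite sum, commutes with the series.\<close>

lemma killed_op_suminf_solution:
  assumes "c good = 0"
  defines "x \<equiv> \<lambda>s. suminf (\<lambda>n. (killed_op good P ^^ n) c s)"
  shows "x s = c s + killed_op good P x s"
proof -
  note S = killed_op_summable[of c, OF assms(1)]
  have "x s = c s + suminf (\<lambda>n. (killed_op good P ^^ Suc n) c s)"
    unfolding x_def using suminf_split_head[OF S] by simp
  also have "suminf (\<lambda>n. (killed_op good P ^^ Suc n) c s) = killed_op good P x s"
  proof (cases "s = good")
    case False
    then show ?thesis
      unfolding x_def using S
      by (simp add: killed_op_def suminf_mult[symmetric] suminf_sum summable_mult)
  qed simp
  finally show ?thesis .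
qed

end

section \<open>Expected rewards as series\<close>

text \<open>Makes the extension theorem available, which is what ties the limit in
  \<open>path_measure\<close> to the one-step kernels.\<close>

lemma Ionescu_Tulcea_mc_step:
  "Ionescu_Tulcea (mc_step K s) (\<lambda>_. count_space UNIV)"
proof (rule Ionescu_Tulcea.intro)
  fix i
  show "mc_step K s i \<in> measurable (PiM {0..<i} (\<lambda>_. count_space UNIV)) (subprob_algebra (count_space UNIV))"
  proof (cases i)
    case 0
    then show ?thesis
      by (auto simp: mc_step_def[abs_def] intro!: measurable_const measure_pmf_in_subprob_algebra)
  next
    case (Suc j)
    have "(\<lambda>\<omega>. measure_pmf (K (\<omega> j))) \<in> measurable (PiM {0..<i} (\<lambda>_. count_space UNIV)) (subprob_algebra (count_space UNIV))"
      by (rule measurable_compose[OF measurable_component_singleton])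
        (auto simp: Suc measure_pmf_in_subprob_algebra)
    then show ?thesis
      by (simp add: mc_step_def[abs_def] Suc)
  qed
next
  fix i x
  show "prob_space (mc_step K s i x)"
    by (simp add: mc_step_def measure_pmf.prob_space_axioms)
qed

text \<open>The bound is inclusive, so this is the event that the reward at position
  \<open>i\<close> is still collected.\<close>

definition alive :: "'s \<Rightarrow> nat \<Rightarrow> (nat \<Rightarrow> 's) \<Rightarrow> bool" where
  "alive good i \<omega> \<longleftrightarrow> (\<forall>j\<le>i. \<omega> j \<noteq> good)"

lemma alive_antimono: "alive good n \<omega> \<Longrightarrow> m \<le> n \<Longrightarrow> alive good m \<omega>"
  by (auto simp: alive_def)

lemma alive_iff_less_Least:
  assumes "\<exists>n. \<omega> n = good"
  shows "alive good i \<omega> \<longleftrightarrow> i < (LEAST n. \<omega> n = good)"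
proof
  assume "alive good i \<omega>"
  moreover have "\<omega> (LEAST n. \<omega> n = good) = good"
    using assms by (rule LeastI_ex)
  ultimately have "\<not> (LEAST n. \<omega> n = good) \<le> i"
    unfolding alive_def by blast
  then show "i < (LEAST n. \<omega> n = good)"
    by simp
next
  assume "i < (LEAST n. \<omega> n = good)"
  then show "alive good i \<omega>"
    unfolding alive_def using not_less_Least le_less_trans by blast
qed

text \<open>The indicator is a finite product of functions of single coordinates, which reduces
  measurability to that of the projections.\<close>

lemma measurable_alive_integrand:
  fixes g :: "'s \<Rightarrow> real"
  assumes "i < n"
  shows "(\<lambda>\<omega>. ennreal (g (\<omega> i)) * of_bool (alive good i \<omega>)) \<in>
     borel_measurable (PiM {0..<n} (\<lambda>_. count_space UNIV))"
proof -
  have h: "(\<lambda>\<omega>. h (\<omega> j)) \<in> borel_measurable (PiM {0..<n} (\<lambda>_. count_space UNIV))"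
    if "j \<le> i" for j and h :: "'s \<Rightarrow> ennreal"
    using that assms by (intro measurable_compose[OF measurable_component_singleton]) auto
  have "(\<lambda>\<omega>. ennreal (g (\<omega> i)) * (\<Prod>j\<le>i. of_bool (\<omega> j \<noteq> good))) \<in>
     borel_measurable (PiM {0..<n} (\<lambda>_. count_space UNIV))"
    by (intro borel_measurable_times_ennreal borel_measurable_prod_ennreal)
      (rule h[where h = "\<lambda>x. ennreal (g x)"] h[where h = "\<lambda>x. of_bool (x \<noteq> good)"], simp)+
  moreover have "(\<Prod>j\<le>i. of_bool (\<omega> j \<noteq> good)) = (of_bool (alive good i \<omega>) :: ennreal)" for \<omega>
    by (induction i) (auto simp: alive_def le_Suc_eq)
  ultimately show ?thesis by simp
qed

section \<open>Finite-dimensional laws of the path measure and expectations before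
  absorption\<close>

context
  fixes K :: "'s::finite \<Rightarrow> 's pmf" and s :: 's
begin

interpretation IT: Ionescu_Tulcea "mc_step K s" "\<lambda>_. count_space UNIV"
  by (rule Ionescu_Tulcea_mc_step)

lemma sets_path_measure: "sets (path_measure K s) = sets (PiM UNIV (\<lambda>_. count_space UNIV))"
  unfolding path_measure_def by simp

lemma space_path_measure [simp]: "space (path_measure K s) = UNIV"
  using sets_eq_imp_space_eq[OF sets_path_measure] by (simp add: space_PiM)

text \<open>The limit measure agrees with the prescribed law on cylinders, and these are the
  preimages under restriction. The start \<open>\<lambda>_. undefined\<close> is the sole point of
  the empty product, that is, the empty history.\<close>

lemma distr_path_measure:
  "distr (path_measure K s) (PiM {0..<n} (\<lambda>_. count_space UNIV)) (\<lambda>\<omega>. restrict \<omega> {0..<n}) =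
     IT.C 0 n (\<lambda>_. undefined)"
proof (rule measure_eqI)
  fix A assume "A \<in> sets (distr (path_measure K s) (PiM {0..<n} (\<lambda>_. count_space UNIV)) (\<lambda>\<omega>. restrict \<omega> {0..<n}))"
  then have A: "A \<in> sets (PiM {0..<n} (\<lambda>_. count_space UNIV))" by simp
  have *: "IT.PF.emb {0..<n} {0..<n} A = A"
    using sets.sets_into_space[OF A] by (intro prod_emb_id) (simp add: space_PiM)
  have "emeasure (path_measure K s) (IT.PF.emb UNIV {0..<n} A) = emeasure (IT.C 0 n (\<lambda>_. undefined)) A"
    unfolding path_measure_def using A * by (simp add: IT.lim IT.emeasure_CI[of _ n])
  moreover have "emeasure (distr (path_measure K s) (PiM {0..<n} (\<lambda>_. count_space UNIV)) (\<lambda>\<omega>. restrict \<omega> {0..<n})) A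
    = emeasure (path_measure K s) (IT.PF.emb UNIV {0..<n} A)"
    using A by (intro emeasure_distr_restrict) (auto simp: sets_path_measure)
  ultimately show "emeasure (distr (path_measure K s) (PiM {0..<n} (\<lambda>_. count_space UNIV)) (\<lambda>\<omega>. restrict \<omega> {0..<n})) A
    = emeasure (IT.C 0 n (\<lambda>_. undefined)) A" by simp
qed (simp add: IT.sets_C)

lemma measurable_restrict_path:
  "(\<lambda>\<omega>. restrict \<omega> {0..<n}) \<in> measurable (path_measure K s) (PiM {0..<n} (\<lambda>_. count_space UNIV))"
  using measurable_cong_sets[OF sets_path_measure refl] by (auto intro!: measurable_restrict_subset)

lemma nn_integral_path_prefix:
  assumes "f \<in> borel_measurable (PiM {0..<n} (\<lambda>_. count_space UNIV))"
  shows "(\<integral>\<^sup>+\<omega>. f (restrict \<omega> {0..<n}) \<partial>path_measure K s) = (\<integral>\<^sup>+\<omega>. f \<omega> \<partial>IT.C 0 n (\<lambda>_. undefined))"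
  unfolding distr_path_measure[symmetric]
  using assms by (simp add: nn_integral_distr[OF measurable_restrict_path])

text \<open>Total mass can be read off any image measure; the law of the empty prefix
  suffices.\<close>

lemma prob_space_path_measure: "prob_space (path_measure K s)"
proof (rule prob_space_distrD[OF measurable_restrict_path])
  show "prob_space (distr (path_measure K s) (PiM {0..<0} (\<lambda>_. count_space UNIV)) (\<lambda>\<omega>. restrict \<omega> {0..<0}))"
    unfolding distr_path_measure by (rule IT.prob_space_C) (simp add: space_PiM)
qed

lemma measurable_component_path [measurable]:
  "(\<lambda>\<omega>. \<omega> i) \<in> measurable (path_measure K s) (count_space UNIV)"
  using measurable_cong_sets[OF sets_path_measure refl] by (auto intro!: measurable_component_singleton)

text \<open>One step of the construction is a bind with \<open>IT.eP n\<close>, which appends a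
  value drawn from \<open>mc_step\<close> at position \<open>n\<close>; the integral becomes an
  iterated one.\<close>

lemma nn_integral_C_Suc:
  assumes f: "f \<in> borel_measurable (PiM {0..<Suc n} (\<lambda>_. count_space UNIV))"
  shows "(\<integral>\<^sup>+\<omega>. f \<omega> \<partial>IT.C 0 (Suc n) (\<lambda>_. undefined)) =
    (\<integral>\<^sup>+\<omega>. (\<integral>\<^sup>+x. f (fun_upd \<omega> n x) \<partial>mc_step K s n \<omega>) \<partial>IT.C 0 n (\<lambda>_. undefined))"
proof -
  have "IT.eP n \<in> measurable (IT.C 0 n (\<lambda>_. undefined)) (subprob_algebra (PiM {0..<Suc n} (\<lambda>_. count_space UNIV)))"
    using IT.measurable_eP[of n] IT.sets_C[of "\<lambda>_. undefined" 0 n]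
    by (subst measurable_cong_sets[OF _ refl]) (auto simp: space_PiM)
  from nn_integral_bind[OF f this]
  have "(\<integral>\<^sup>+\<omega>. f \<omega> \<partial>IT.C 0 (Suc n) (\<lambda>_. undefined)) =
    (\<integral>\<^sup>+\<omega>. (\<integral>\<^sup>+x. f x \<partial>IT.eP n \<omega>) \<partial>IT.C 0 n (\<lambda>_. undefined))"
    by simp
  also have "\<dots> = (\<integral>\<^sup>+\<omega>. (\<integral>\<^sup>+x. f (fun_upd \<omega> n x) \<partial>mc_step K s n \<omega>) \<partial>IT.C 0 n (\<lambda>_. undefined))"
    by (intro nn_integral_cong IT.nn_integral_eP f) (simp add: IT.space_C space_PiM)
  finally show ?thesis .
qed

text \<open>Integrating out the last position replaces \<open>g\<close> by its image under the
  operator, one position earlier, so the induction runs over all \<open>g\<close>. Since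
  \<open>g good = 0\<close>, avoiding \<open>good\<close> at the last position comes for free; being
  alive at position \<open>i\<close> hides the killing at \<open>good\<close>.\<close>

lemma nn_integral_alive_C:
  assumes g: "\<And>t. 0 \<le> g t" and good: "g good = 0"
  shows "(\<integral>\<^sup>+\<omega>. ennreal (g (\<omega> i)) * of_bool (alive good i \<omega>) \<partial>IT.C 0 (Suc i) (\<lambda>_. undefined)) =
    ennreal ((killed_op good (\<lambda>a b. pmf (K a) b) ^^ i) g s)"
  using assms
proof (induction i arbitrary: g)
  case 0
  have "(\<integral>\<^sup>+\<omega>. ennreal (g (\<omega> 0)) * of_bool (alive good 0 \<omega>) \<partial>IT.C 0 (Suc 0) (\<lambda>_. undefined)) =
    (\<integral>\<^sup>+\<omega>. (\<integral>\<^sup>+x. ennreal (g x) * of_bool (x \<noteq> good) \<partial>return_pmf s) \<partial>IT.C 0 0 (\<lambda>_. undefined))"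
    by (subst nn_integral_C_Suc) (auto intro!: measurable_alive_integrand simp del: IT.C.simps simp: alive_def mc_step_def)
  also have "\<dots> = ennreal (g s) * of_bool (s \<noteq> good)"
    using prob_space.emeasure_space_1[OF IT.prob_space_C[of "\<lambda>_. undefined" 0 0]]
    by (simp add: nn_integral_return space_PiM del: IT.C.simps)
  also have "\<dots> = ennreal (g s)" using 0 by auto
  finally show ?case by simp
next
  case (Suc i)
  let ?P = "\<lambda>a b. pmf (K a) b"
  have nonneg: "0 \<le> killed_op good ?P g t" for t
    using Suc.prems by (auto simp: killed_op_def intro!: sum_nonneg)
  have inner: "(\<integral>\<^sup>+x. ennreal (g ((fun_upd \<omega> (Suc i) x) (Suc i))) * of_bool (alive good (Suc i) (fun_upd \<omega> (Suc i) x)) \<partial>mc_step K s (Suc i) \<omega>)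
      = ennreal (killed_op good ?P g (\<omega> i)) * of_bool (alive good i \<omega>)" for \<omega>
  proof -
    have "ennreal (g ((fun_upd \<omega> (Suc i) x) (Suc i))) * of_bool (alive good (Suc i) (fun_upd \<omega> (Suc i) x)) =
        ennreal (g x) * of_bool (alive good i \<omega>)" for x
      using Suc.prems by (auto simp: alive_def le_Suc_eq)
    then have "(\<integral>\<^sup>+x. ennreal (g ((fun_upd \<omega> (Suc i) x) (Suc i))) * of_bool (alive good (Suc i) (fun_upd \<omega> (Suc i) x)) \<partial>mc_step K s (Suc i) \<omega>)
      = (\<integral>\<^sup>+x. ennreal (g x) * of_bool (alive good i \<omega>) \<partial>K (\<omega> i))"
      by (simp add: mc_step_def)
    also have "\<dots> = (\<Sum>x\<in>UNIV. ennreal (g x) * of_bool (alive good i \<omega>) * pmf (K (\<omega> i)) x)"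
      by (subst nn_integral_measure_pmf_support[of UNIV]) auto
    also have "\<dots> = (\<Sum>x\<in>UNIV. ennreal (pmf (K (\<omega> i)) x * g x)) * of_bool (alive good i \<omega>)"
      using Suc.prems by (simp add: ennreal_mult sum_distrib_right ac_simps)
    also have "\<dots> = ennreal (\<Sum>x\<in>UNIV. pmf (K (\<omega> i)) x * g x) * of_bool (alive good i \<omega>)"
      using Suc.prems by (subst sum_ennreal) auto
    also have "\<dots> = ennreal (killed_op good ?P g (\<omega> i)) * of_bool (alive good i \<omega>)"
      by (auto simp: killed_op_def alive_def)
    finally show ?thesis .
  qed
  \<comment> \<open>The induction hypothesis puts the new factor innermost;
    \<open>funpow_swap1\<close> moves it to the outside.\<close>
  show ?case
    by (subst nn_integral_C_Suc)
      (simp_all only: measurable_alive_integrand inner lessI Suc.IH[of "killed_op good ?P g", OF nonneg killed_op_good] funpow_swap1 funpow.simps comp_apply)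
qed

lemma nn_integral_alive:
  assumes "\<And>t. 0 \<le> g t" "g good = 0"
  shows "(\<integral>\<^sup>+\<omega>. ennreal (g (\<omega> i)) * of_bool (alive good i \<omega>) \<partial>path_measure K s) =
    ennreal ((killed_op good (\<lambda>a b. pmf (K a) b) ^^ i) g s)"
proof -
  have "(\<integral>\<^sup>+\<omega>. ennreal (g (\<omega> i)) * of_bool (alive good i \<omega>) \<partial>path_measure K s) =
     (\<integral>\<^sup>+\<omega>. ennreal (g (restrict \<omega> {0..<Suc i} i)) * of_bool (alive good i (restrict \<omega> {0..<Suc i})) \<partial>path_measure K s)"
    by (simp add: alive_def)
  also have "\<dots> = (\<integral>\<^sup>+\<omega>. ennreal (g (\<omega> i)) * of_bool (alive good i \<omega>) \<partial>IT.C 0 (Suc i) (\<lambda>_. undefined))"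
    by (rule nn_integral_path_prefix) (rule measurable_alive_integrand, simp)
  also note nn_integral_alive_C[of g good i, OF assms]
  finally show ?thesis .
qed

lemma measurable_alive [measurable]:
  "Measurable.pred (path_measure K s) (alive good i)"
  unfolding alive_def by measurable

text \<open>A signed \<open>g\<close> is split into positive and negative part, both zero at
  \<open>good\<close>; linearity of the iterates recombines them.\<close>

lemma has_integral_alive:
  assumes good: "g good = (0::real)"
  shows "has_bochner_integral (path_measure K s) (\<lambda>\<omega>. g (\<omega> i) * of_bool (alive good i \<omega>))
    ((killed_op good (\<lambda>a b. pmf (K a) b) ^^ i) g s)"
proof -
  let ?B = "killed_op good (\<lambda>a b. pmf (K a) b) ^^ i"
  have nonneg: "has_bochner_integral (path_measure K s) (\<lambda>\<omega>. h (\<omega> i) * of_bool (alive good i \<omega>)) (?B h s)"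
    if h: "\<And>t. 0 \<le> h t" "h good = 0" for h :: "'s \<Rightarrow> real"
  proof (rule has_bochner_integral_nn_integral)
    show "(\<lambda>\<omega>. h (\<omega> i) * of_bool (alive good i \<omega>)) \<in> borel_measurable (path_measure K s)"
      by measurable
    show "0 \<le> ?B h s"
      by (rule killed_op_funpow_nonneg) (auto simp: h)
    have "ennreal (h (\<omega> i) * of_bool (alive good i \<omega>)) = ennreal (h (\<omega> i)) * of_bool (alive good i \<omega>)" for \<omega>
      by simp
    then show "(\<integral>\<^sup>+\<omega>. ennreal (h (\<omega> i) * of_bool (alive good i \<omega>)) \<partial>path_measure K s) = ennreal (?B h s)"
      by (simp only: nn_integral_alive[of h good i, OF h])
  qed (use h in auto)
  have "has_bochner_integral (path_measure K s)
     (\<lambda>\<omega>. max 0 (g (\<omega> i)) * of_bool (alive good i \<omega>) - max 0 (- g (\<omega> i)) * of_bool (alive good i \<omega>))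
     (?B (\<lambda>t. max 0 (g t)) s - ?B (\<lambda>t. max 0 (- g t)) s)"
    by (intro has_bochner_integral_diff nonneg) (auto simp: good)
  moreover have "?B (\<lambda>t. max 0 (g t)) s - ?B (\<lambda>t. max 0 (- g t)) s = ?B (\<lambda>t. max 0 (g t) - max 0 (- g t)) s"
    by (rule killed_op_funpow_diff[symmetric])
  moreover have "max 0 x - max 0 (- x) = x" for x :: real
    by simp
  ultimately show ?thesis
    by (simp add: left_diff_distrib[symmetric])
qed

text \<open>The iterates are the probabilities of the decreasing events \<open>alive good i\<close>,
  so this is continuity from above. It serves in both directions: reachability yields a Lyapunov
  function, and a Lyapunov function yields almost sure hitting.\<close>

lemma tendsto_alive:
  "(\<lambda>i. (killed_op good (\<lambda>a b. pmf (K a) b) ^^ i) (\<lambda>t. of_bool (t \<noteq> good)) s)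
    \<longlonglongrightarrow> measure (path_measure K s) {\<omega>. \<forall>n. \<omega> n \<noteq> good}"
proof -
  interpret prob_space "path_measure K s"
    by (rule prob_space_path_measure)
  have meas: "{\<omega>. alive good i \<omega>} \<in> sets (path_measure K s)" for i
    using predE[OF measurable_alive[of good i]] by simp
  have "(killed_op good (\<lambda>a b. pmf (K a) b) ^^ i) (\<lambda>t. of_bool (t \<noteq> good)) s =
      measure (path_measure K s) {\<omega>. alive good i \<omega>}" for i
  proof -
    have "(\<lambda>\<omega>. of_bool (\<omega> i \<noteq> good) * of_bool (alive good i \<omega>)) = (indicator {\<omega>. alive good i \<omega>} :: _ \<Rightarrow> real)"
      by (auto simp: alive_def fun_eq_iff split: split_indicator)
    then show ?thesis
      using has_bochner_integral_integral_eq[OF has_integral_alive[of "\<lambda>t. of_bool (t \<noteq> good)" good i]] meas[of i]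
      by simp
  qed
  moreover have "(\<lambda>i. measure (path_measure K s) {\<omega>. alive good i \<omega>})
      \<longlonglongrightarrow> measure (path_measure K s) (\<Inter>i. {\<omega>. alive good i \<omega>})"
    by (rule finite_Lim_measure_decseq) (use meas in \<open>auto simp: decseq_def intro: alive_antimono\<close>)
  moreover have "(\<Inter>i. {\<omega>. alive good i \<omega>}) = {\<omega>. \<forall>n. \<omega> n \<noteq> good}"
    by (auto simp: alive_def)
  ultimately show ?thesis by simp
qed

text \<open>Integrability makes both parts finite, so the extended real difference is an ordinary
  one.\<close>

lemma ereal_expectation_integral:
  assumes "AE \<omega> in N. f \<omega> = ereal (X \<omega>)" "integrable N X"
  shows "ereal_expectation N f = ereal (integral\<^sup>L N X)"
proof -
  have "(\<integral>\<^sup>+\<omega>. e2ennreal (f \<omega>) \<partial>N) = (\<integral>\<^sup>+\<omega>. ennreal (X \<omega>) \<partial>N)"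
    and "(\<integral>\<^sup>+\<omega>. e2ennreal (- f \<omega>) \<partial>N) = (\<integral>\<^sup>+\<omega>. ennreal (- X \<omega>) \<partial>N)"
    using assms(1) by (auto intro!: nn_integral_cong_AE elim!: eventually_mono)
  moreover have "enn2ereal a = ereal (enn2real a)" if "a \<noteq> top" for a
    using that by (cases a) auto
  ultimately show ?thesis
    using assms(2) by (auto simp: ereal_expectation_def real_lebesgue_integral_def real_integrable_def)
qed

text \<open>The path reward is almost surely the series of rewards collected while alive, and
  summable L1 norms justify integrating termwise. Assuming a Lyapunov function rather than
  reachability makes the formula usable at instantiations near the region as well.\<close>

lemma ereal_expectation_path_reward:
  assumes lyap: "lyapunov good (\<lambda>a b. pmf (K a) b) \<delta> w"
  shows "ereal_expectation (path_measure K s) (path_reward {good} rew) =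
    ereal (suminf (\<lambda>i. (killed_op good (\<lambda>a b. pmf (K a) b) ^^ i) (rew(good := 0)) s))"
proof -
  interpret prob_space "path_measure K s"
    by (rule prob_space_path_measure)
  let ?B = "killed_op good (\<lambda>a b. pmf (K a) b)"
  note summable = killed_op_summable[of "\<lambda>a b. pmf (K a) b" good \<delta> w, OF pmf_nonneg lyap]
  \<comment> \<open>The probability of never hitting \<open>good\<close> is the limit of the terms
    of a convergent series.\<close>
  have "measure (path_measure K s) {\<omega>. \<forall>n. \<omega> n \<noteq> good} = 0"
    by (rule LIMSEQ_unique[OF tendsto_alive summable_LIMSEQ_zero[OF summable]]) simp
  moreover have "{\<omega> \<in> space (path_measure K s). \<forall>n. \<omega> n \<noteq> good} \<in> sets (path_measure K s)"
    by measurable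
  ultimately have hit: "AE \<omega> in path_measure K s. \<exists>n. \<omega> n = good"
    by (intro AE_I[of _ _ "{\<omega>. \<forall>n. \<omega> n \<noteq> good}"]) (auto simp: emeasure_eq_measure)
  define f where "f i \<omega> = (rew(good := 0)) (\<omega> i) * of_bool (alive good i \<omega>)" for i \<omega>
  have int_f: "has_bochner_integral (path_measure K s) (f i) ((?B ^^ i) (rew(good := 0)) s)" for i
    unfolding f_def by (rule has_integral_alive) simp
  have int_norm: "integral\<^sup>L (path_measure K s) (\<lambda>\<omega>. norm (f i \<omega>)) = (?B ^^ i) (\<lambda>t. \<bar>(rew(good := 0)) t\<bar>) s" for i
    using has_bochner_integral_integral_eq[OF has_integral_alive[of "\<lambda>t. \<bar>(rew(good := 0)) t\<bar>" good i]]
    by (simp add: f_def[abs_def] abs_mult del: fun_upd_apply) simp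
  have 1: "integrable (path_measure K s) (f i)" for i
    using int_f by (simp add: has_bochner_integral_iff)
  have 2: "AE \<omega> in path_measure K s. summable (\<lambda>i. norm (f i \<omega>))"
    using hit
  proof eventually_elim
    case (elim \<omega>)
    show ?case
      by (rule summable_finite[of "{..<LEAST n. \<omega> n = good}"]) (auto simp: f_def alive_iff_less_Least[OF elim])
  qed
  have 3: "summable (\<lambda>i. integral\<^sup>L (path_measure K s) (\<lambda>\<omega>. norm (f i \<omega>)))"
    unfolding int_norm by (rule summable) simp
  have "AE \<omega> in path_measure K s. path_reward {good} rew \<omega> = ereal (suminf (\<lambda>i. f i \<omega>))"
    using hit
  proof eventually_elim
    case (elim \<omega>)
    have "suminf (\<lambda>i. f i \<omega>) = (\<Sum>i<(LEAST n. \<omega> n = good). f i \<omega>)"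
      by (rule suminf_finite) (auto simp: f_def alive_iff_less_Least[OF elim])
    also have "\<dots> = (\<Sum>i<(LEAST n. \<omega> n = good). rew (\<omega> i))"
      using alive_iff_less_Least[OF elim] by (intro sum.cong) (auto simp: f_def alive_def)
    finally show ?case
      using elim by (simp add: path_reward_def)
  qed
  then have "ereal_expectation (path_measure K s) (path_reward {good} rew) =
      ereal (integral\<^sup>L (path_measure K s) (\<lambda>\<omega>. suminf (\<lambda>i. f i \<omega>)))"
    by (rule ereal_expectation_integral) (rule integrable_suminf[OF 1 2 3])
  also have "integral\<^sup>L (path_measure K s) (\<lambda>\<omega>. suminf (\<lambda>i. f i \<omega>)) =
      suminf (\<lambda>i. integral\<^sup>L (path_measure K s) (f i))"
    by (rule integral_suminf[OF 1 2 3])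
  also have "\<dots> = suminf (\<lambda>i. (?B ^^ i) (rew(good := 0)) s)"
    using int_f by (simp add: has_bochner_integral_iff)
  finally show ?thesis .
qed

end

section \<open>Evaluation and partial derivatives of polynomials\<close>

text \<open>The product runs over all parameters, those of exponent 0 contributing 1, so that every
  monomial has the same index set.\<close>

definition monom_eval :: "('v \<Rightarrow>\<^sub>0 nat) \<Rightarrow> ('v::finite) inst \<Rightarrow> real" where
  "monom_eval m u = (\<Prod>q\<in>UNIV. u q ^ Poly_Mapping.lookup m q)"

text \<open>Extra monomials have coefficient 0; a common index set lets two polynomials be added
  termwise.\<close>

lemma mpoly_eval_superset:
  fixes f :: "('v::finite) mpoly"
  assumes "finite A" "Poly_Mapping.keys f \<subseteq> A"
  shows "mpoly_eval f u = (\<Sum>m\<in>A. Poly_Mapping.lookup f m * monom_eval m u)"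
proof -
  have "(\<Prod>q\<in>Poly_Mapping.keys m. u q ^ Poly_Mapping.lookup m q) = monom_eval m u" for m
    unfolding monom_eval_def by (rule prod.mono_neutral_left) (auto simp: in_keys_iff)
  then have "mpoly_eval f u = (\<Sum>m\<in>Poly_Mapping.keys f. Poly_Mapping.lookup f m * monom_eval m u)"
    by (simp add: mpoly_eval_def)
  also have "\<dots> = (\<Sum>m\<in>A. Poly_Mapping.lookup f m * monom_eval m u)"
    using assms by (intro sum.mono_neutral_left) (auto simp: in_keys_iff)
  finally show ?thesis .
qed

lemma mpoly_eval_add:
  fixes f :: "('v::finite) mpoly"
  shows "mpoly_eval (f + g) u = mpoly_eval f u + mpoly_eval g u"
proof -
  let ?A = "Poly_Mapping.keys f \<union> Poly_Mapping.keys g"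
  have "Poly_Mapping.keys (f + g) \<subseteq> ?A" by (rule Poly_Mapping.keys_add)
  then show ?thesis
    by (simp add: mpoly_eval_superset[of ?A] lookup_add distrib_right sum.distrib)
qed

lemma mpoly_eval_sum:
  fixes f :: "'a \<Rightarrow> ('v::finite) mpoly"
  shows "mpoly_eval (\<Sum>i\<in>I. f i) u = (\<Sum>i\<in>I. mpoly_eval (f i) u)"
  by (induction I rule: infinite_finite_induct) (simp_all add: mpoly_eval_add, simp_all add: mpoly_eval_def)

lemma mpoly_eval_single:
  fixes m :: "('v::finite) \<Rightarrow>\<^sub>0 nat"
  shows "mpoly_eval (Poly_Mapping.single m a) u = a * monom_eval m u"
  by (subst mpoly_eval_superset[of "{m}"]) auto

lemma monom_eval_split:
  "monom_eval m u = u p ^ Poly_Mapping.lookup m p * (\<Prod>q\<in>UNIV - {p}. u q ^ Poly_Mapping.lookup m q)"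
  unfolding monom_eval_def by (rule prod.remove) auto

lemma monom_eval_deriv:
  "((\<lambda>t. monom_eval m (u(p := t))) has_real_derivative
     real (Poly_Mapping.lookup m p) * monom_eval (m - Poly_Mapping.single p 1) (u(p := t))) (at t within U)"
proof -
  have "monom_eval m (u(p := t)) =
      t ^ Poly_Mapping.lookup m p * (\<Prod>q\<in>UNIV - {p}. u q ^ Poly_Mapping.lookup m q)" for t
    by (simp add: monom_eval_split[where p = p])
  \<comment> \<open>Truncated subtraction is also what the power rule uses, so exponent 0 needs no
    separate case.\<close>
  moreover have "monom_eval (m - Poly_Mapping.single p 1) (u(p := t)) =
      t ^ (Poly_Mapping.lookup m p - 1) * (\<Prod>q\<in>UNIV - {p}. u q ^ Poly_Mapping.lookup m q)"
    by (simp add: monom_eval_split[where p = p] lookup_minus lookup_single when_def)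
  ultimately show ?thesis
    by (auto intro!: derivative_eq_intros)
qed

lemma mpoly_eval_deriv:
  fixes f :: "('v::finite) mpoly"
  shows "((\<lambda>t. mpoly_eval f (u(p := t))) has_real_derivative
    mpoly_eval (mpoly_pderiv p f) (u(p := t))) (at t within U)"
proof -
  have "mpoly_eval (mpoly_pderiv p f) (u(p := t)) =
    (\<Sum>m\<in>Poly_Mapping.keys f. Poly_Mapping.lookup f m *
       (real (Poly_Mapping.lookup m p) * monom_eval (m - Poly_Mapping.single p 1) (u(p := t))))"
    by (simp add: mpoly_pderiv_def mpoly_eval_sum mpoly_eval_single mult.assoc)
  moreover have "(\<lambda>t. mpoly_eval f (u(p := t))) =
    (\<lambda>t. \<Sum>m\<in>Poly_Mapping.keys f. Poly_Mapping.lookup f m * monom_eval m (u(p := t)))"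
    by (simp add: mpoly_eval_superset[of "Poly_Mapping.keys f"])
  ultimately show ?thesis
    by (simp only:) (intro DERIV_sum DERIV_cmult monom_eval_deriv)
qed

section \<open>Differentiating the solution\<close>

lemma pmf_inst_kernel:
  fixes M :: "('s::finite, 'v) pmc"
  assumes "is_pmc lb ub M" "u \<in> param_space lb ub"
  shows "pmf (inst_kernel M u s) t = mpoly_eval (trans M s t) u"
proof -
  have nonneg: "0 \<le> mpoly_eval (trans M s t) u" and sum: "(\<Sum>t\<in>UNIV. mpoly_eval (trans M s t) u) = 1" for t
    using assms by (auto simp: is_pmc_def)
  show ?thesis
    unfolding inst_kernel_def
  proof (rule pmf_embed_pmf)
    show "(\<integral>\<^sup>+t. ennreal (mpoly_eval (trans M s t) u) \<partial>count_space UNIV) = 1"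
      by (simp add: nn_integral_count_space_finite sum nonneg)
  qed (rule nonneg)
qed

text \<open>As the operator vanishes at \<open>good\<close>, an inhomogeneity set to 0 there
  expresses the boundary condition.\<close>

lemma killed_op_zero_at_good:
  "x good = 0 \<and> (\<forall>s. s \<noteq> good \<longrightarrow> x s = c s + (\<Sum>t\<in>UNIV. P s t * x t))
    \<longleftrightarrow> (\<forall>s. x s = (c(good := 0)) s + killed_op good P x s)"
  by (auto simp: killed_op_def)

text \<open>For fixed \<open>w\<close> the drift condition consists of finitely many inequalities
  continuous in the matrix; giving up \<delta>/2 leaves room for a small change.\<close>

lemma lyapunov_perturb:
  fixes good :: "'s::finite"
  assumes lyap: "lyapunov good P \<delta> w"
    and lim: "\<And>s t. ((\<lambda>z. Q z s t) \<longlongrightarrow> P s t) F"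
  shows "\<forall>\<^sub>F z in F. lyapunov good (Q z) (\<delta> / 2) w"
proof -
  have \<delta>: "0 < \<delta>" using lyap by (simp add: lyapunov_def)
  have "((\<lambda>z. killed_op good (Q z) w s) \<longlongrightarrow> killed_op good P w s) F" for s
    unfolding killed_op_def by (cases "s = good") (auto intro!: tendsto_intros lim)
  then have "\<forall>\<^sub>F z in F. killed_op good (Q z) w s < killed_op good P w s + \<delta> / 2" for s
    using \<delta> by (intro order_tendstoD(2)) auto
  then have "\<forall>\<^sub>F z in F. \<forall>s. killed_op good (Q z) w s < killed_op good P w s + \<delta> / 2"
    by (rule eventually_all_finite)
  then show ?thesis
  proof eventually_elim
    case (elim z)
    have "\<delta> / 2 + killed_op good (Q z) w s \<le> w s" if "s \<noteq> good" for s
      using elim[rule_format, of s] lyap that by (force simp: lyapunov_def)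
    then show ?case
      using lyap by (simp add: lyapunov_def)
  qed
qed

text \<open>The error of the difference quotient solves a system of the same kind, whose inhomogeneity
  vanishes in the limit; the Lyapunov function bounds its solution by the inhomogeneity.\<close>

lemma killed_op_solution_deriv:
  fixes good :: "'s::finite" and P :: "real \<Rightarrow> 's \<Rightarrow> 's \<Rightarrow> real"
  assumes P_nonneg: "\<And>t a b. t \<in> U \<Longrightarrow> 0 \<le> P t a b"
    and P_deriv: "\<And>a b. ((\<lambda>t. P t a b) has_real_derivative P' a b) (at t0 within U)"
    and lyap: "lyapunov good (P t0) \<delta> w"
    and y: "\<forall>\<^sub>F t in at t0 within U. \<forall>s. y t s = c s + killed_op good (P t) (y t) s"
    and y0: "\<And>s. y t0 s = c s + killed_op good (P t0) (y t0) s"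
    and d: "\<And>s. d s = killed_op good P' (y t0) s + killed_op good (P t0) d s"
    and c: "c good = 0"
  shows "((\<lambda>t. y t s) has_real_derivative d s) (at t0 within U)"
proof -
  let ?F = "at t0 within U"
  \<comment> \<open>\<open>e\<close> is the error of the difference quotient. The residual
    \<open>r\<close> involves the solution only through the fixed vectors \<open>y t0\<close> and
    \<open>d\<close>, hence tends to 0.\<close>
  define e where "e t s = (y t s - y t0 s) / (t - t0) - d s" for t s
  define r where "r t s = killed_op good (\<lambda>a b. (P t a b - P t0 a b) / (t - t0) - P' a b) (y t0) s
     + killed_op good (\<lambda>a b. P t a b - P t0 a b) d s" for t s
  have P_lim: "((\<lambda>t. P t a b) \<longlongrightarrow> P t0 a b) ?F" for a b
    using DERIV_continuous[OF P_deriv] by (simp add: continuous_within)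
  have P'_lim: "((\<lambda>t. (P t a b - P t0 a b) / (t - t0)) \<longlongrightarrow> P' a b) ?F" for a b
    using P_deriv by (simp add: has_field_derivative_iff)
  have r_lim: "((\<lambda>t. r t s) \<longlongrightarrow> 0) ?F" for s
  proof (cases "s = good")
    case False
    have "((\<lambda>t. (\<Sum>b\<in>UNIV. ((P t s b - P t0 s b) / (t - t0) - P' s b) * y t0 b)
        + (\<Sum>b\<in>UNIV. (P t s b - P t0 s b) * d b)) \<longlongrightarrow>
      (\<Sum>b\<in>UNIV. (P' s b - P' s b) * y t0 b) + (\<Sum>b\<in>UNIV. (P t0 s b - P t0 s b) * d b)) ?F"
      by (intro tendsto_add tendsto_sum tendsto_mult tendsto_diff P'_lim P_lim tendsto_const)
    then show ?thesis
      using False by (simp add: r_def killed_op_def)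
  qed (simp add: r_def)
  \<comment> \<open>The sum of the residuals bounds each of them, as \<open>lyapunov_bound\<close>
    requires; \<delta>/2 is the drift that survives the perturbation.\<close>
  have "((\<lambda>t. (\<Sum>a\<in>UNIV. \<bar>r t a\<bar>) / (\<delta> / 2) * w s) \<longlongrightarrow> (\<Sum>a\<in>(UNIV :: 's set). \<bar>0\<bar>) / (\<delta> / 2) * w s) ?F"
    using lyap by (intro tendsto_mult tendsto_divide tendsto_sum tendsto_rabs tendsto_const r_lim)
      (auto simp: lyapunov_def)
  then have bound_lim: "((\<lambda>t. (\<Sum>a\<in>UNIV. \<bar>r t a\<bar>) / (\<delta> / 2) * w s) \<longlongrightarrow> 0) ?F"
    by simp
  have "\<forall>\<^sub>F t in ?F. t \<in> U \<and> t \<noteq> t0"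
    by (simp add: eventually_at_filter)
  with y lyapunov_perturb[OF lyap P_lim]
  have "\<forall>\<^sub>F t in ?F. \<bar>e t s\<bar> \<le> (\<Sum>a\<in>UNIV. \<bar>r t a\<bar>) / (\<delta> / 2) * w s"
  proof eventually_elim
    case (elim t)
    have "e t a = r t a + killed_op good (P t) (e t) a" for a
    proof (cases "a = good")
      case True
      then show ?thesis
        using elim(1)[rule_format, of good] y0[of good] d[of good] c by (simp add: e_def r_def)
    next
      case False
      define h where "h = inverse (t - t0)"
      have "y t a - y t0 a = (\<Sum>b\<in>UNIV. P t a b * y t b - P t0 a b * y t0 b)"
        using elim(1)[rule_format, of a] y0[of a] False by (simp add: killed_op_def sum_subtractf)
      moreover have "d a = (\<Sum>b\<in>UNIV. P' a b * y t0 b + P t0 a b * d b)"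
        using d[of a] False by (simp add: killed_op_def sum.distrib)
      ultimately have "e t a = (\<Sum>b\<in>UNIV. (P t a b * y t b - P t0 a b * y t0 b) * h - (P' a b * y t0 b + P t0 a b * d b))"
        unfolding e_def by (simp only: divide_inverse h_def[symmetric] sum_distrib_right) (simp only: sum_subtractf)
      \<comment> \<open>The terms are grouped so that the error occurs only under
        \<open>P t\<close>, for which \<open>w\<close> is still a Lyapunov function.\<close>
      also have "\<dots> = (\<Sum>b\<in>UNIV. ((P t a b - P t0 a b) * h - P' a b) * y t0 b
          + (P t a b - P t0 a b) * d b + P t a b * ((y t b - y t0 b) * h - d b))"
        by (intro sum.cong) (auto simp: algebra_simps)
      also have "\<dots> = r t a + killed_op good (P t) (e t) a"
        using False by (simp add: r_def e_def killed_op_def divide_inverse h_def sum.distrib)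
      finally show ?thesis .
    qed
    then show ?case
    proof (rule lyapunov_bound[of "P t" good "\<delta> / 2" w, rotated 2])
      show "\<bar>r t a\<bar> \<le> (\<Sum>a\<in>UNIV. \<bar>r t a\<bar>)" for a
        by (rule member_le_sum) auto
    qed (use elim P_nonneg in \<open>auto simp: r_def\<close>)
  qed
  then have "((\<lambda>t. e t s) \<longlongrightarrow> 0) ?F"
    by (intro Lim_null_comparison[OF _ bound_lim]) simp
  then have "((\<lambda>t. e t s + d s) \<longlongrightarrow> 0 + d s) ?F"
    by (intro tendsto_intros)
  then show ?thesis
    by (simp add: e_def has_field_derivative_iff)
qed

text \<open>Turns equations at the points of \<open>R\<close> into an equation of functions, which
  is the form that unique existence requires.\<close>

lemma extensional_eq_restrict_iff:
  "f \<in> extensional R \<and> (\<forall>u\<in>R. f u = h u) \<longleftrightarrow> f = restrict h R"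
proof
  assume "f \<in> extensional R \<and> (\<forall>u\<in>R. f u = h u)"
  then show "f = restrict h R"
    by (intro extensionalityI[of f R]) auto
qed auto

theorem theorem1:
  fixes M :: "('s::finite, 'v::finite) pmc"
    and good :: 's
    and rew :: "'s \<Rightarrow> real"
    and lb ub :: "'v \<Rightarrow> real"
    and R :: "'v inst set"
    and p :: 'v
  assumes "is_pmc lb ub M"
    and "target M = {good}"
    and "R \<subseteq> param_space lb ub"
    and "graph_preserving M R"
    and "\<And>s u. u \<in> R \<Longrightarrow> \<P>(\<omega> in path_measure (inst_kernel M u) s. \<exists>n. \<omega> n = good) = 1"
  shows "(\<exists>!(x, dx). solves_system M rew good p R x dx) \<and>
    (\<forall>x dx. solves_system M rew good p R x dx \<longrightarrow>
       (\<forall>s. \<forall>u\<in>R.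
          ereal (x s u) = exp_reward M rew s u \<and>
          has_partial_derivative (\<lambda>v. real_of_ereal (exp_reward M rew s v)) p (dx s u) u
            (param_space lb ub)))"
proof -
  define P where "P u s t = mpoly_eval (trans M s t) u" for u s t
  define P' where "P' u s t = mpoly_eval (mpoly_pderiv p (trans M s t)) u" for u s t
  \<comment> \<open>The Neumann series at \<open>u\<close>, which solves the system with
    inhomogeneity \<open>c\<close> wherever a Lyapunov function exists.\<close>
  define V where "V u c s = suminf (\<lambda>n. (killed_op good (P u) ^^ n) c s)" for u c s
  define c where "c = rew(good := 0)"
  have P_nonneg: "0 \<le> P u s t" if "u \<in> param_space lb ub" for u s t
    using assms(1) that by (auto simp: is_pmc_def P_def)
  have kernel: "(\<lambda>a b. pmf (inst_kernel M u a) b) = P u" if "u \<in> param_space lb ub" for u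
    using pmf_inst_kernel[OF assms(1) that] by (simp add: P_def fun_eq_iff)
  have lyap: "\<exists>w. lyapunov good (P u) (1/2) w" if "u \<in> R" for u
  proof (rule lyapunov_exists)
    have u: "u \<in> param_space lb ub" using assms(3) that by blast
    show "0 \<le> P u s t" for s t using P_nonneg[OF u] .
    fix s
    let ?N = "path_measure (inst_kernel M u) s"
    interpret prob_space ?N by (rule prob_space_path_measure)
    have "{\<omega> \<in> space ?N. \<exists>n. \<omega> n = good} \<in> sets ?N" by measurable
    then have "prob (space ?N - {\<omega> \<in> space ?N. \<exists>n. \<omega> n = good}) = 0"
      using assms(5)[OF that, of s] by (simp only: prob_compl)
    moreover have "space ?N - {\<omega> \<in> space ?N. \<exists>n. \<omega> n = good} = {\<omega>. \<forall>n. \<omega> n \<noteq> good}" by auto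
    ultimately show "(\<lambda>n. (killed_op good (P u) ^^ n) (\<lambda>s. of_bool (s \<noteq> good)) s) \<longlonglongrightarrow> 0"
      using tendsto_alive[of good "inst_kernel M u" s] by (simp add: kernel[OF u])
  qed
  have V: "V u g s = g s + killed_op good (P u) (V u g) s"
    if "u \<in> param_space lb ub" "lyapunov good (P u) \<delta> w" "g good = 0" for u \<delta> w g s
    using killed_op_suminf_solution[of "P u" good \<delta> w g s, OF P_nonneg[OF that(1)] that(2,3)]
    by (simp add: V_def[abs_def])
  \<comment> \<open>This is proved on the parameter space rather than on \<open>R\<close>, because
    the partial derivative is taken within the whole box.\<close>
  have ER: "exp_reward M rew s u = ereal (V u c s)"
    if "u \<in> param_space lb ub" "lyapunov good (P u) \<delta> w" for u \<delta> w s
    using ereal_expectation_path_reward[of good "inst_kernel M u" \<delta> w s rew] that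
    by (simp add: exp_reward_def assms(2) kernel V_def c_def)
  \<comment> \<open>The inhomogeneity of the derivative equations, with the solution of the reward
    equations already inserted.\<close>
  define g where "g u = killed_op good (P' u) (V u c)" for u
  have solves_iff: "solves_system M rew good p R x dx \<longleftrightarrow>
      x = (\<lambda>s. \<lambda>u\<in>R. V u c s) \<and> dx = (\<lambda>s. \<lambda>u\<in>R. V u (g u) s)" for x dx
  proof -
    have "x good u = 0 \<and> dx good u = 0 \<and> (\<forall>s. s \<noteq> good \<longrightarrow>
           x s u = rew s + (\<Sum>t\<in>UNIV. mpoly_eval (trans M s t) u * x t u) \<and>
           dx s u = (\<Sum>t\<in>UNIV. mpoly_eval (mpoly_pderiv p (trans M s t)) u * x t u
                              + mpoly_eval (trans M s t) u * dx t u))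
       \<longleftrightarrow> (\<forall>s. x s u = V u c s) \<and> (\<forall>s. dx s u = V u (g u) s)"
      (is "?system \<longleftrightarrow> _") if uR: "u \<in> R" for u
    proof -
      have u: "u \<in> param_space lb ub" using assms(3) uR by blast
      obtain w where w: "lyapunov good (P u) (1/2) w" using lyap[OF uR] by blast
      have solution: "(\<forall>s. z s = a s + killed_op good (P u) z s) \<longleftrightarrow> (\<forall>s. z s = V u a s)"
        if "a good = 0" for z a
      proof
        assume "\<forall>s. z s = a s + killed_op good (P u) z s"
        then have "z = V u a"
          using V[OF u w, of a, OF that]
          by (intro killed_op_solution_unique[of "P u" good "1/2" w z a "V u a", OF P_nonneg[OF u] w]) auto
        then show "\<forall>s. z s = V u a s" by simp
      next
        assume "\<forall>s. z s = V u a s"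
        then have "z = V u a" by auto
        then show "\<forall>s. z s = a s + killed_op good (P u) z s"
          using V[OF u w, of a, OF that] by blast
      qed
      have "?system \<longleftrightarrow> (\<forall>s. x s u = c s + killed_op good (P u) (\<lambda>s. x s u) s) \<and>
          (\<forall>s. dx s u = killed_op good (P' u) (\<lambda>s. x s u) s + killed_op good (P u) (\<lambda>s. dx s u) s)"
      proof -
        have "?system \<longleftrightarrow>
          (x good u = 0 \<and> (\<forall>s. s \<noteq> good \<longrightarrow> x s u = rew s + (\<Sum>t\<in>UNIV. P u s t * x t u))) \<and>
          (dx good u = 0 \<and> (\<forall>s. s \<noteq> good \<longrightarrow> dx s u =
            (\<Sum>t\<in>UNIV. P' u s t * x t u) + (\<Sum>t\<in>UNIV. P u s t * dx t u)))"
          unfolding P_def P'_def sum.distrib by blast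
        moreover have "((\<lambda>s. \<Sum>t\<in>UNIV. P' u s t * x t u)(good := 0)) = killed_op good (P' u) (\<lambda>s. x s u)"
          by (auto simp: killed_op_def)
        ultimately show ?thesis
          unfolding c_def
          using killed_op_zero_at_good[of "\<lambda>s. x s u" good rew "P u"]
            killed_op_zero_at_good[of "\<lambda>s. dx s u" good "\<lambda>s. \<Sum>t\<in>UNIV. P' u s t * x t u" "P u"]
          by (simp only:)
      qed
      \<comment> \<open>The system is triangular: the first block determines \<open>x\<close>, which
        may then be substituted into the second.\<close>
      also have "\<dots> \<longleftrightarrow> (\<forall>s. x s u = V u c s) \<and>
          (\<forall>s. dx s u = g u s + killed_op good (P u) (\<lambda>s. dx s u) s)"
        (is "?l \<longleftrightarrow> ?r")
      proof -
        have "?l \<longleftrightarrow> (\<lambda>s. x s u) = V u c \<and>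
          (\<forall>s. dx s u = killed_op good (P' u) (\<lambda>s. x s u) s + killed_op good (P u) (\<lambda>s. dx s u) s)"
          using solution[of c "\<lambda>s. x s u"] by (simp add: c_def fun_eq_iff)
        also have "\<dots> \<longleftrightarrow> (\<lambda>s. x s u) = V u c \<and>
          (\<forall>s. dx s u = g u s + killed_op good (P u) (\<lambda>s. dx s u) s)"
          unfolding g_def by (rule conj_cong) simp_all
        finally show ?thesis by (simp only: fun_eq_iff)
      qed
      also have "\<dots> \<longleftrightarrow> (\<forall>s. x s u = V u c s) \<and> (\<forall>s. dx s u = V u (g u) s)"
        using solution[of "g u" "\<lambda>s. dx s u"] by (simp add: g_def)
      finally show ?thesis .
    qed
    then have "solves_system M rew good p R x dx \<longleftrightarrow> (\<forall>s. x s \<in> extensional R \<and> dx s \<in> extensional R) \<and>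
        (\<forall>u\<in>R. (\<forall>s. x s u = V u c s) \<and> (\<forall>s. dx s u = V u (g u) s))"
      by (simp add: solves_system_def)
    also have "\<dots> \<longleftrightarrow> (\<forall>s. x s \<in> extensional R \<and> (\<forall>u\<in>R. x s u = V u c s)) \<and>
        (\<forall>s. dx s \<in> extensional R \<and> (\<forall>u\<in>R. dx s u = V u (g u) s))"
      by blast
    also have "\<dots> \<longleftrightarrow> (\<forall>s. x s = (\<lambda>u\<in>R. V u c s)) \<and> (\<forall>s. dx s = (\<lambda>u\<in>R. V u (g u) s))"
      by (simp only: extensional_eq_restrict_iff)
    finally show ?thesis
      by (simp only: fun_eq_iff[where f = x] fun_eq_iff[where f = dx])
  qed
  have deriv: "has_partial_derivative (\<lambda>v. real_of_ereal (exp_reward M rew s v)) p (V u (g u) s) u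
      (param_space lb ub)" if uR: "u \<in> R" for s u
  proof -
    have u: "u \<in> param_space lb ub" using assms(3) uR by blast
    obtain w where w: "lyapunov good (P u) (1/2) w" using lyap[OF uR] by blast
    let ?U = "{t. u(p := t) \<in> param_space lb ub}"
    have P_deriv: "((\<lambda>t. P (u(p := t)) a b) has_real_derivative P' u a b) (at (u p) within ?U)" for a b
      using mpoly_eval_deriv[of "trans M a b" u p "u p" ?U] by (simp add: P_def P'_def)
    have P_lim: "((\<lambda>t. P (u(p := t)) a b) \<longlongrightarrow> P u a b) (at (u p) within ?U)" for a b
      using DERIV_continuous[OF P_deriv] by (simp add: continuous_within)
    have "\<forall>\<^sub>F t in at (u p) within ?U. t \<in> ?U"
      by (simp add: eventually_at_filter)
    \<comment> \<open>Neighbouring points of the box may lie outside \<open>R\<close>; there the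
      perturbed Lyapunov function takes the place of the reachability assumption.\<close>
    with lyapunov_perturb[OF w P_lim]
    have sol: "\<forall>\<^sub>F t in at (u p) within ?U. \<forall>s. real_of_ereal (exp_reward M rew s (u(p := t))) =
        c s + killed_op good (P (u(p := t))) (\<lambda>s. real_of_ereal (exp_reward M rew s (u(p := t)))) s"
    proof eventually_elim
      case (elim t)
      then have t: "u(p := t) \<in> param_space lb ub" by simp
      have "V (u(p := t)) c s = c s + killed_op good (P (u(p := t))) (V (u(p := t)) c) s" for s
        by (rule V[OF t elim(1)]) (simp add: c_def)
      then show ?case
        unfolding ER[OF t elim(1)] real_of_ereal.simps by blast
    qed
    have c: "c good = 0" and g: "g u good = 0"
      by (simp_all add: c_def g_def)
    show ?thesis
      unfolding has_partial_derivative_def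
    proof (rule killed_op_solution_deriv[where P = "\<lambda>t. P (u(p := t))" and P' = "P' u" and good = good
          and w = w and \<delta> = "1/2" and c = c and d = "V u (g u)"
          and y = "\<lambda>t s. real_of_ereal (exp_reward M rew s (u(p := t)))"])
      show "real_of_ereal (exp_reward M rew s (u(p := u p))) =
          c s + killed_op good (P (u(p := u p))) (\<lambda>s. real_of_ereal (exp_reward M rew s (u(p := u p)))) s" for s
        unfolding fun_upd_triv ER[OF u w] real_of_ereal.simps by (rule V[of u, OF u w, of c, OF c])
      show "V u (g u) s = killed_op good (P' u) (\<lambda>s. real_of_ereal (exp_reward M rew s (u(p := u p)))) s +
          killed_op good (P (u(p := u p))) (V u (g u)) s" for s
        unfolding fun_upd_triv ER[OF u w] real_of_ereal.simps
        using V[of u, OF u w, of "g u", OF g] by (simp only: g_def)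
    qed (use P_nonneg w c P_deriv sol in simp_all)
  qed
  show ?thesis
  proof (intro conjI allI impI ballI)
    show "\<exists>!(x, dx). solves_system M rew good p R x dx"
      unfolding solves_iff by auto
  next
    fix x dx s u
    assume "solves_system M rew good p R x dx" and u: "u \<in> R"
    then have x: "x s u = V u c s" "dx s u = V u (g u) s"
      by (simp_all add: solves_iff)
    obtain w where "lyapunov good (P u) (1/2) w" using lyap[OF u] by blast
    then show "ereal (x s u) = exp_reward M rew s u"
      using ER[of u] u assms(3) by (auto simp: x)
    show "has_partial_derivative (\<lambda>v. real_of_ereal (exp_reward M rew s v)) p (dx s u) u (param_space lb ub)"
      using deriv[OF u] by (simp add: x)
  qed
qed

end
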